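(* The set of codes for closed Ramsey-null sets, i.e. $\{T\in\mathrm{Tree}_\omega : [T] \text{ is Ramsey-null}\}$, is a $\mathbf{\Pi}_1^1$-complete subset of $\mathrm{Tree}_\omega$.
   Context: A tree over $\omega$ is a set $T\subseteq\omega^{<\omega}$ closed under initial segments. $\mathrm{Tree}_\omega$ is the set of all trees over $\omega$, a Polish space as a $G_\delta$ subset of $\mathcal{P}(\omega^{<\omega})\cong 2^{\omega^{<\omega}}$ (product topology). The body of $T$ is $[T]=\{x\in\omega^\omega : (\forall n)\ x\upharpoonright n\in T\}$; $T$ is regarded as a code for the closed set $[T]\subseteq\omega^\omega$. Ramsey-null: infinite subsets of $\omega$ are identified with strictly increasing elements of $\omega^\omega$ (their increasing enumerations). For a finite strictly increasing sequence $s$ and an infinite $S\subseteq\omega$ with $\max(\mathrm{rng}(s))<\min S$ (no condition if $s=\emptyset$), let $[s,S]$ be the set of strictly increasing $x\in\omega^\omega$ extending $s$ with $\mathrm{rng}(x)\setminus\mathrm{rng}(s)\subseteq S$. A set $A\subseteq\omega^\omega$ is Ramsey-null if for every such pair $(s,S)$ there is an infinite $S'\subseteq S$ with $[s,S']\cap A=\emptyset$. Completeness: for Polish spaces $\mathcal{X},\mathcal{Y}$ and $A\subseteq\mathcal{X}$, $B\subseteq\mathcal{Y}$, $B$ is Borel reducible to $A$ if there is a Borel function $f:\mathcal{Y}\to\mathcal{X}$ with $f^{-1}[A]=B$. $A\subseteq\mathcal{X}$ is $\mathbf{\Sigma}_1^1$-complete if $A$ is analytic and for every Polish space $\mathcal{Y}$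 every analytic $B\subseteq\mathcal{Y}$ is Borel reducible to $A$. $A\subseteq\mathcal{X}$ is $\mathbf{\Pi}_1^1$-complete if $\mathcal{X}\setminus A$ is $\mathbf{\Sigma}_1^1$-complete. *)

theory Defs
  imports "HOL-Analysis.Analysis"
begin

section \<open>Polish spaces, Borel reductions and complete sets\<close>

definition polish :: "'a topology \<Rightarrow> bool" where
  "polish X \<longleftrightarrow> completely_metrizable_space X \<and> second_countable X"

definition borel_of :: "'a topology \<Rightarrow> 'a measure" where
  "borel_of X = sigma (topspace X) {U. openin X U}"

definition baire_space :: "(nat \<Rightarrow> nat) topology" where
  "baire_space = product_topology (\<lambda>_. discrete_topology UNIV) UNIV"

definition analytic_in :: "'a topology \<Rightarrow> 'a set \<Rightarrow> bool" where
  "analytic_in X A \<longleftrightarrow>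
     A = {} \<or> (\<exists>f. continuous_map baire_space X f \<and> f ` topspace baire_space = A)"

definition borel_reducible :: "'b topology \<Rightarrow> 'b set \<Rightarrow> 'a topology \<Rightarrow> 'a set \<Rightarrow> bool" where
  "borel_reducible Y B X A \<longleftrightarrow>
     (\<exists>f \<in> measurable (borel_of Y) (borel_of X). f -` A \<inter> topspace Y = B)"

text \<open>A HOL formula cannot quantify over types.  The carrier type \<open>'b\<close> of the Polish spaces
  \<open>Y\<close> in the hardness clause is therefore a parameter: a theorem stated with
  a free type variable \<open>'b\<close> covers every Polish space over every type.\<close>

definition Sigma11_complete :: "'b itself \<Rightarrow> 'a topology \<Rightarrow> 'a set \<Rightarrow> bool" where
  "Sigma11_complete TYPE('b) X A \<longleftrightarrow>
     polish X \<and> A \<subseteq> topspace X \<and> analytic_in X A \<and>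
     (\<forall>(Y :: 'b topology) B. polish Y \<and> analytic_in Y B \<longrightarrow> borel_reducible Y B X A)"

definition Pi11_complete :: "'b itself \<Rightarrow> 'a topology \<Rightarrow> 'a set \<Rightarrow> bool" where
  "Pi11_complete TYPE('b) X A \<longleftrightarrow>
     A \<subseteq> topspace X \<and> Sigma11_complete TYPE('b) X (topspace X - A)"

section \<open>Trees over the natural numbers\<close>

definition Trees :: "nat list set set" where
  "Trees = {T. \<forall>s t. s @ t \<in> T \<longrightarrow> s \<in> T}"

text \<open>The power set of the finite sequences is identified with the product of copies of the
  discrete two-point space through characteristic functions.\<close>

definition tree_space :: "nat list set topology" where
  "tree_space =
     subtopology
       (pullback_topology UNIV (\<lambda>T s. s \<in> T)
         (product_topology (\<lambda>_. discrete_topology (UNIV :: bool set)) (UNIV :: nat list set)))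
       Trees"

definition body :: "nat list set \<Rightarrow> (nat \<Rightarrow> nat) set" where
  "body T = {x. \<forall>n. map x [0..<n] \<in> T}"

section \<open>Ramsey-null sets\<close>

definition ramsey_pair :: "nat list \<Rightarrow> nat set \<Rightarrow> bool" where
  "ramsey_pair s S \<longleftrightarrow>
     sorted_wrt (<) s \<and> infinite S \<and> (\<forall>a \<in> set s. \<forall>b \<in> S. a < b)"

definition ramsey_nbhd :: "nat list \<Rightarrow> nat set \<Rightarrow> (nat \<Rightarrow> nat) set" where
  "ramsey_nbhd s S =
     {x. strict_mono x \<and> map x [0..<length s] = s \<and> range x - set s \<subseteq> S}"

definition ramsey_null :: "(nat \<Rightarrow> nat) set \<Rightarrow> bool" where
  "ramsey_null A \<longleftrightarrow>
     (\<forall>s S. ramsey_pair s S \<longrightarrow> (\<exists>S' \<subseteq> S. infinite S' \<and> ramsey_nbhd s S' \<inter> A = {}))"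

end

theory Submission
  imports Defs
begin

text \<open>Closed sets are Ramsey (Galvin--Prikry), so \<open>[T]\<close> fails to be Ramsey-null exactly when it
  contains a whole neighbourhood \<open>[s, S]\<close>, i.e. when \<open>T\<close> contains the tree of all increasing
  sequences compatible with \<open>s\<close> and \<open>S\<close>.  The codes of sets that are not Ramsey-null are thus the
  unions of an arbitrary tree with such a cone, and they are parametrised continuously by the Baire
  space.

  For hardness, let \<open>B = g ` \<omega>\<^sup>\<omega>\<close> be a nonempty analytic subset of \<open>Y\<close>.  Map \<open>y\<close> to the tree of all
  \<open>s\<close> that dominate pointwise some \<open>t\<close> of the same length with \<open>y\<close> in the closure of \<open>g ` N\<^sub>t\<close>,
  where \<open>N\<^sub>t\<close> is the set of extensions of \<open>t\<close>.  If \<open>y = g z\<close>, every sufficiently fast growing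
  increasing sequence, together with all its subsequences, is a branch.  Conversely, a branch yields
  by Koenig's lemma some \<open>z\<close> below it with \<open>g z = y\<close>, so for \<open>y \<notin> B\<close> the body is
  empty.\<close>

section \<open>Topology of the space of trees\<close>

text \<open>A basic box restricts finitely many coordinates, and over discrete factors it can be
  shrunk to fixing them. Openness becomes finite dependence, for number sequences and characteristic
  functions alike.\<close>

lemma openin_power_discrete:
  fixes S :: "('i \<Rightarrow> 'a) set"
  shows "openin (product_topology (\<lambda>_. discrete_topology UNIV) UNIV) S \<longleftrightarrow>
    (\<forall>x\<in>S. \<exists>K. finite K \<and> (\<forall>x'. (\<forall>k\<in>K. x' k = x k) \<longrightarrow> x' \<in> S))"
proof -
  have "(\<exists>U. finite {i. U i \<noteq> (UNIV :: 'a set)} \<and> x \<in> Pi\<^sub>E UNIV U \<and> Pi\<^sub>E UNIV U \<subseteq> S) \<longleftrightarrow>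
      (\<exists>K. finite K \<and> (\<forall>x'. (\<forall>k\<in>K. x' k = x k) \<longrightarrow> x' \<in> S))" for x
  proof
    assume "\<exists>U. finite {i. U i \<noteq> (UNIV :: 'a set)} \<and> x \<in> Pi\<^sub>E UNIV U \<and> Pi\<^sub>E UNIV U \<subseteq> S"
    then obtain U where U: "finite {i. U i \<noteq> (UNIV :: 'a set)}" "x \<in> Pi\<^sub>E UNIV U" "Pi\<^sub>E UNIV U \<subseteq> S"
      by blast
    have "x' \<in> S" if "\<forall>k\<in>{i. U i \<noteq> UNIV}. x' k = x k" for x'
    proof -
      have "x' i \<in> U i" for i
        using that U(2) by (cases "U i = UNIV") (auto simp: PiE_iff)
      then show ?thesis
        using U(3) by (auto simp: PiE_iff)
    qed
    with U(1) show "\<exists>K. finite K \<and> (\<forall>x'. (\<forall>k\<in>K. x' k = x k) \<longrightarrow> x' \<in> S)"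
      by blast
  next
    assume "\<exists>K. finite K \<and> (\<forall>x'. (\<forall>k\<in>K. x' k = x k) \<longrightarrow> x' \<in> S)"
    then obtain K where K: "finite K" "\<And>x'. \<forall>k\<in>K. x' k = x k \<Longrightarrow> x' \<in> S"
      by blast
    let ?U = "\<lambda>i. if i \<in> K then {x i} else UNIV"
    have "finite {i. ?U i \<noteq> UNIV}"
      by (rule finite_subset[OF _ K(1)]) auto
    moreover have "x \<in> Pi\<^sub>E UNIV ?U"
      by (simp add: PiE_iff)
    moreover have "Pi\<^sub>E UNIV ?U \<subseteq> S"
    proof
      fix x' assume "x' \<in> Pi\<^sub>E UNIV ?U"
      then have U: "x' k \<in> ?U k" for k
        by (rule PiE_mem) simp
      have "x' k = x k" if "k \<in> K" for k
        using U[of k] that by simp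
      then show "x' \<in> S"
        by (intro K(2)) blast
    qed
    ultimately show "\<exists>U. finite {i. U i \<noteq> (UNIV :: 'a set)} \<and> x \<in> Pi\<^sub>E UNIV U \<and> Pi\<^sub>E UNIV U \<subseteq> S"
      by (intro exI[of _ ?U] conjI)
  qed
  then show ?thesis
    by (simp add: openin_product_topology_alt)
qed

lemma topspace_baire_space [simp]: "topspace baire_space = UNIV"
  by (simp add: baire_space_def)

lemma openin_baire_space_dependence:
  assumes "finite K" "\<And>x x'. (\<And>k. k \<in> K \<Longrightarrow> x' k = x k) \<Longrightarrow> P x \<Longrightarrow> P x'"
  shows "openin baire_space {x. P x}"
  unfolding baire_space_def openin_power_discrete
proof
  fix x assume "x \<in> {x. P x}"
  then have "\<forall>x'. (\<forall>k\<in>K. x' k = x k) \<longrightarrow> x' \<in> {x. P x}"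
    using assms(2)[of _ x] by simp
  with assms(1) show "\<exists>K. finite K \<and> (\<forall>x'. (\<forall>k\<in>K. x' k = x k) \<longrightarrow> x' \<in> {x. P x})"
    by (intro exI[of _ K] conjI)
qed

lemma TreesI: "(\<And>s t. s @ t \<in> T \<Longrightarrow> s \<in> T) \<Longrightarrow> T \<in> Trees"
  unfolding Trees_def by blast

lemma TreesD: "T \<in> Trees \<Longrightarrow> s @ t \<in> T \<Longrightarrow> s \<in> T"
  unfolding Trees_def by blast

lemma topspace_tree_space [simp]: "topspace tree_space = Trees"
  by (simp add: tree_space_def topspace_pullback_topology)

lemma openin_tree_space:
  "openin tree_space U \<longleftrightarrow>
    U \<subseteq> Trees \<and> (\<forall>T\<in>U. \<exists>F. finite F \<and> (\<forall>T'\<in>Trees. T' \<inter> F = T \<inter> F \<longrightarrow> T' \<in> U))"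
    (is "?lhs \<longleftrightarrow> ?rhs")
proof
  assume ?lhs
  then obtain V where V: "openin (product_topology (\<lambda>_. discrete_topology UNIV) UNIV) V"
    and U: "U = (\<lambda>T s. s \<in> T) -` V \<inter> Trees"
    unfolding tree_space_def openin_subtopology openin_pullback_topology by auto
  show ?rhs
  proof (intro conjI ballI)
    fix T assume "T \<in> U"
    then have "(\<lambda>s. s \<in> T) \<in> V"
      using U by auto
    from bspec[OF V[unfolded openin_power_discrete] this]
    obtain F where F: "finite F" "\<forall>x'. (\<forall>k\<in>F. x' k = (k \<in> T)) \<longrightarrow> x' \<in> V"
      by (elim exE conjE)
    have "T' \<in> U" if "T' \<in> Trees" "T' \<inter> F = T \<inter> F" for T'
    proof -
      have "\<forall>k\<in>F. (k \<in> T') = (k \<in> T)"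
        using that(2) by blast
      then have "(\<lambda>s. s \<in> T') \<in> V"
        using spec[OF F(2), of "\<lambda>s. s \<in> T'"] by simp
      then show ?thesis
        using U that(1) by auto
    qed
    with F(1) show "\<exists>F. finite F \<and> (\<forall>T'\<in>Trees. T' \<inter> F = T \<inter> F \<longrightarrow> T' \<in> U)"
      by blast
  qed (use U in blast)
next
  assume R: ?rhs
  \<comment> \<open>\<open>V\<close> is the union of all basic boxes whose trees lie in
    \<open>U\<close>. The image of \<open>U\<close> itself need not be open, since a box also
    contains characteristic functions of sets that are not trees.\<close>
  define V where "V = {c. \<exists>T\<in>U. \<exists>F. finite F \<and> (\<forall>T'\<in>Trees. T' \<inter> F = T \<inter> F \<longrightarrow> T' \<in> U) \<and>
      (\<forall>s\<in>F. c s = (s \<in> T))}"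
  have "openin (product_topology (\<lambda>_. discrete_topology UNIV) UNIV) V"
    unfolding openin_power_discrete
  proof
    fix c assume "c \<in> V"
    then obtain T F where TF: "T \<in> U" "finite F" "\<forall>T'\<in>Trees. T' \<inter> F = T \<inter> F \<longrightarrow> T' \<in> U"
      "\<forall>s\<in>F. c s = (s \<in> T)"
      unfolding V_def by blast
    then have "c' \<in> V" if "\<forall>k\<in>F. c' k = c k" for c'
      unfolding V_def using that by blast
    with TF(2) show "\<exists>K. finite K \<and> (\<forall>c'. (\<forall>k\<in>K. c' k = c k) \<longrightarrow> c' \<in> V)"
      by blast
  qed
  moreover have "U = (\<lambda>T s. s \<in> T) -` V \<inter> Trees"
  proof
    show "U \<subseteq> (\<lambda>T s. s \<in> T) -` V \<inter> Trees"
    proof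
      fix T assume "T \<in> U"
      moreover from this obtain F where "finite F" "\<forall>T'\<in>Trees. T' \<inter> F = T \<inter> F \<longrightarrow> T' \<in> U"
        using R by blast
      ultimately have "(\<lambda>s. s \<in> T) \<in> V"
        unfolding V_def mem_Collect_eq by (intro bexI[of _ T] exI[of _ F]) simp_all
      then show "T \<in> (\<lambda>T s. s \<in> T) -` V \<inter> Trees"
        using R \<open>T \<in> U\<close> by auto
    qed
    show "(\<lambda>T s. s \<in> T) -` V \<inter> Trees \<subseteq> U"
    proof
      fix T' assume T': "T' \<in> (\<lambda>T s. s \<in> T) -` V \<inter> Trees"
      then have "(\<lambda>s. s \<in> T') \<in> V"
        by simp
      then obtain T F where "\<forall>T'\<in>Trees. T' \<inter> F = T \<inter> F \<longrightarrow> T' \<in> U" "\<forall>s\<in>F. (s \<in> T') = (s \<in> T)"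
        unfolding V_def mem_Collect_eq by (elim bexE exE conjE)
      moreover from this(2) have "T' \<inter> F = T \<inter> F"
        by blast
      ultimately show "T' \<in> U"
        using T' by blast
    qed
  qed
  ultimately show ?lhs
    unfolding tree_space_def openin_subtopology openin_pullback_topology by auto
qed

section \<open>A countable base for the space of trees\<close>

text \<open>If \<open>E\<close> is not contained in \<open>F\<close>, the cylinder is empty. Hence
  all pairs of finite sets can index a countable base.\<close>

definition tree_cylinder :: "nat list set \<Rightarrow> nat list set \<Rightarrow> nat list set set" where
  "tree_cylinder F E = {T \<in> Trees. T \<inter> F = E}"

definition finite_set_pairs :: "(nat list set \<times> nat list set) set" where
  "finite_set_pairs = {F. finite F} \<times> {E. finite E}"

lemma countable_finite_set_pairs: "countable finite_set_pairs"
  unfolding finite_set_pairs_def by (intro countable_SIGMA countable_Collect_finite)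

lemma openin_tree_cylinder: "finite F \<Longrightarrow> openin tree_space (tree_cylinder F E)"
  unfolding openin_tree_space tree_cylinder_def by blast

lemma openin_tree_space_cylinder:
  assumes "openin tree_space U" "T \<in> U"
  shows "\<exists>(F, E) \<in> finite_set_pairs. T \<in> tree_cylinder F E \<and> tree_cylinder F E \<subseteq> U"
proof -
  obtain F where F: "finite F" "\<forall>T'\<in>Trees. T' \<inter> F = T \<inter> F \<longrightarrow> T' \<in> U"
    using assms unfolding openin_tree_space by blast
  have "T \<in> Trees"
    using assms unfolding openin_tree_space by blast
  with F have "(F, T \<inter> F) \<in> finite_set_pairs" "T \<in> tree_cylinder F (T \<inter> F)"
    "tree_cylinder F (T \<inter> F) \<subseteq> U"
    unfolding finite_set_pairs_def tree_cylinder_def by auto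
  then show ?thesis
    by blast
qed

text \<open>Characteristic functions identify the power set with a countable product of two-point
  spaces, in which \<open>Trees\<close> is closed: a missing initial segment is witnessed by two
  coordinates.\<close>

lemma polish_tree_space: "polish tree_space"
  unfolding polish_def
proof
  let ?C = "product_topology (\<lambda>_. discrete_topology (UNIV :: bool set)) (UNIV :: nat list set)"
  let ?P = "pullback_topology UNIV (\<lambda>T s. s \<in> T) ?C"
  have "completely_metrizable_space ?C"
    unfolding completely_metrizable_space_product_topology
    by (simp add: completely_metrizable_space_discrete_topology)
  moreover have "homeomorphic_maps ?C ?P Collect (\<lambda>T s. s \<in> T)"
  proof -
    have "continuous_map ?C ?P Collect"
      by (rule continuous_map_pullback') (simp_all add: comp_def)
    moreover have "continuous_map ?P ?C (\<lambda>T s. s \<in> T)"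
      using continuous_map_pullback[OF continuous_map_id, of UNIV "\<lambda>T s. s \<in> T" ?C] by simp
    ultimately show ?thesis
      by (simp add: homeomorphic_maps_def comp_def)
  qed
  ultimately have "completely_metrizable_space ?P"
    using homeomorphic_completely_metrizable_space homeomorphic_space_def by blast
  moreover have "closedin ?P Trees"
  proof -
    have "openin ?C {c. \<exists>s t. c (s @ t) \<and> \<not> c s}"
      unfolding openin_power_discrete
    proof safe
      fix c :: "nat list \<Rightarrow> bool" and s t
      assume "c (s @ t)" "\<not> c s"
      then show "\<exists>K. finite K \<and> (\<forall>c'. (\<forall>k\<in>K. c' k = c k) \<longrightarrow> c' \<in> {c. \<exists>s t. c (s @ t) \<and> \<not> c s})"
        by (intro exI[of _ "{s @ t, s}"]) auto
    qed
    moreover have "- Trees = (\<lambda>T s. s \<in> T) -` {c. \<exists>s t. c (s @ t) \<and> \<not> c s} \<inter> UNIV"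
      unfolding Trees_def by auto
    ultimately have "openin ?P (- Trees)"
      unfolding openin_pullback_topology by blast
    then show ?thesis
      by (simp add: closedin_def topspace_pullback_topology Compl_eq_Diff_UNIV)
  qed
  ultimately show "completely_metrizable_space tree_space"
    unfolding tree_space_def by (rule completely_metrizable_space_closedin)
  show "second_countable tree_space"
    unfolding second_countable_def
  proof (intro exI conjI allI impI ballI)
    show "countable ((\<lambda>(F, E). tree_cylinder F E) ` finite_set_pairs)"
      using countable_finite_set_pairs by (rule countable_image)
    show "openin tree_space V" if "V \<in> (\<lambda>(F, E). tree_cylinder F E) ` finite_set_pairs" for V
      using that by (auto simp: finite_set_pairs_def openin_tree_cylinder)
    show "\<exists>V\<in>(\<lambda>(F, E). tree_cylinder F E) ` finite_set_pairs. T \<in> V \<and> V \<subseteq> U"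
      if "openin tree_space U \<and> T \<in> U" for U T
      using openin_tree_space_cylinder[of U T] that by force
  qed
qed

section \<open>Continuous and Borel maps into the space of trees\<close>

lemma continuous_map_tree_space:
  assumes "\<And>y. y \<in> topspace Y \<Longrightarrow> f y \<in> Trees"
    and "\<And>s. openin Y {y \<in> topspace Y. s \<in> f y}" "\<And>s. openin Y {y \<in> topspace Y. s \<notin> f y}"
  shows "continuous_map Y tree_space f"
  unfolding continuous_map
proof (intro conjI allI impI)
  fix U assume U: "openin tree_space U"
  show "openin Y {y \<in> topspace Y. f y \<in> U}"
  proof (subst openin_subopen, intro ballI)
    fix y assume y: "y \<in> {y \<in> topspace Y. f y \<in> U}"
    then obtain F where F: "finite F" "\<forall>T'\<in>Trees. T' \<inter> F = f y \<inter> F \<longrightarrow> T' \<in> U"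
      using U unfolding openin_tree_space by blast
    define W where "W = topspace Y \<inter> (\<Inter>s\<in>F. {z \<in> topspace Y. (s \<in> f z) = (s \<in> f y)})"
    have "openin Y {z \<in> topspace Y. (s \<in> f z) = (s \<in> f y)}" for s
      using assms(2,3) by (cases "s \<in> f y") auto
    then have "openin Y W"
      unfolding W_def using F(1)
      by (cases "F = {}") (auto intro!: openin_Int openin_INT2)
    moreover have "y \<in> W"
      using y by (auto simp: W_def)
    moreover have "W \<subseteq> {y \<in> topspace Y. f y \<in> U}"
    proof
      fix z assume z: "z \<in> W"
      then have "f z \<inter> F = f y \<inter> F" "z \<in> topspace Y"
        by (auto simp: W_def)
      then show "z \<in> {y \<in> topspace Y. f y \<in> U}"
        using F(2) assms(1) by simp
    qed
    ultimately show "\<exists>W. openin Y W \<and> y \<in> W \<and> W \<subseteq> {y \<in> topspace Y. f y \<in> U}"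
      by blast
  qed
qed (use assms(1) in auto)

lemma space_borel_of [simp]: "space (borel_of X) = topspace X"
  by (simp add: borel_of_def space_measure_of_conv)

lemma openin_borel_of: "openin X U \<Longrightarrow> U \<in> sets (borel_of X)"
  unfolding borel_of_def using openin_subset[of X] by (subst sets_measure_of) auto

lemma closedin_borel_of: "closedin X C \<Longrightarrow> C \<in> sets (borel_of X)"
  using sets.compl_sets[OF openin_borel_of, of X "topspace X - C"]
  by (simp add: closedin_def double_diff)

text \<open>An open set is a countable union of cylinders, and the preimage of a cylinder is a
  finite Boolean combination of the sets in the second assumption.\<close>

lemma measurable_tree_space:
  assumes "\<And>y. y \<in> topspace Y \<Longrightarrow> f y \<in> Trees"
    and "\<And>s. {y \<in> topspace Y. s \<in> f y} \<in> sets (borel_of Y)"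
  shows "f \<in> measurable (borel_of Y) (borel_of tree_space)"
  unfolding borel_of_def[of tree_space]
proof (rule measurable_measure_of)
  fix U assume "U \<in> {U. openin tree_space U}"
  then have U: "openin tree_space U"
    by simp
  let ?I = "{(F, E) \<in> finite_set_pairs. tree_cylinder F E \<subseteq> U}"
  \<comment> \<open>Letting \<open>s\<close> range over \<open>F \<union> E\<close> while demanding
    \<open>s \<in> F\<close> makes \<open>?A F E\<close> empty unless
    \<open>E \<subseteq> F\<close>, in accordance with the cylinder.\<close>
  let ?A = "\<lambda>F E. {y \<in> space (borel_of Y). \<forall>s\<in>F \<union> E. s \<in> F \<and> (s \<in> f y) = (s \<in> E)}"
  have cyl: "f y \<in> tree_cylinder F E \<longleftrightarrow> y \<in> ?A F E" if "y \<in> topspace Y" for y F E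
    using that assms(1) unfolding tree_cylinder_def by auto
  have "?A F E \<in> sets (borel_of Y)" if "finite F" "finite E" for F E
  proof -
    have "{y \<in> space (borel_of Y). s \<in> F \<and> (s \<in> f y) = (s \<in> E)} \<in> sets (borel_of Y)" for s
      using assms(2)[of s] sets.sets_Collect_neg[of "borel_of Y" "\<lambda>y. s \<in> f y"]
      by (cases "s \<in> F"; cases "s \<in> E") simp_all
    then show ?thesis
      using that by (intro sets.sets_Collect_finite_All) auto
  qed
  then have "(\<Union>(F, E)\<in>?I. ?A F E) \<in> sets (borel_of Y)"
    by (intro sets.countable_UN' countable_subset[OF _ countable_finite_set_pairs])
      (auto simp: finite_set_pairs_def)
  moreover have "f -` U \<inter> space (borel_of Y) = (\<Union>(F, E)\<in>?I. ?A F E)"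
  proof (intro set_eqI iffI)
    fix y assume "y \<in> f -` U \<inter> space (borel_of Y)"
    then have y: "f y \<in> U" "y \<in> topspace Y"
      by auto
    obtain F E where FE: "(F, E) \<in> finite_set_pairs" "f y \<in> tree_cylinder F E" "tree_cylinder F E \<subseteq> U"
      using openin_tree_space_cylinder[OF U y(1)] by blast
    have "(F, E) \<in> ?I"
      using FE(1,3) by simp
    moreover have "y \<in> ?A F E"
      using cyl[OF y(2)] FE(2) by blast
    ultimately show "y \<in> (\<Union>(F, E)\<in>?I. ?A F E)"
      by blast
  next
    fix y assume "y \<in> (\<Union>(F, E)\<in>?I. ?A F E)"
    then obtain F E where FE: "(F, E) \<in> ?I" "y \<in> ?A F E"
      by blast
    moreover from this have "y \<in> topspace Y"
      by simp
    ultimately show "y \<in> f -` U \<inter> space (borel_of Y)"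
      using cyl[of y F E] by auto
  qed
  ultimately show "f -` U \<inter> space (borel_of Y) \<in> sets (borel_of Y)"
    by simp
qed (use assms(1) openin_subset[of tree_space] in auto)

section \<open>Closed sets are Ramsey\<close>

text \<open>When \<open>(u, X)\<close> is a \<open>ramsey_pair\<close>, this says that it refutes
  \<open>ramsey_null A\<close>. No order between \<open>u\<close> and \<open>X\<close> is imposed,
  so \<open>X\<close> may stay the same while the stem grows.\<close>

definition ramsey_large :: "(nat \<Rightarrow> nat) set \<Rightarrow> nat list \<Rightarrow> nat set \<Rightarrow> bool" where
  "ramsey_large A u X \<longleftrightarrow> (\<forall>Y\<subseteq>X. infinite Y \<longrightarrow> ramsey_nbhd u Y \<inter> A \<noteq> {})"

lemma ramsey_large_subset: "ramsey_large A u X \<Longrightarrow> Y \<subseteq> X \<Longrightarrow> ramsey_large A u Y"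
  unfolding ramsey_large_def by (meson subset_trans)

lemma ramsey_nbhd_mono: "X \<subseteq> Y \<Longrightarrow> ramsey_nbhd u X \<subseteq> ramsey_nbhd u Y"
  unfolding ramsey_nbhd_def by auto

lemma ramsey_nbhd_nth:
  assumes "x \<in> ramsey_nbhd u X" "i < length u"
  shows "x i = u ! i"
proof -
  have "map x [0..<length u] = u"
    using assms(1) by (simp add: ramsey_nbhd_def)
  moreover have "map x [0..<length u] ! i = x i"
    using assms(2) by simp
  ultimately show ?thesis
    by argo
qed

lemma ramsey_nbhd_tail:
  assumes "x \<in> ramsey_nbhd u X" "length u \<le> j"
  shows "x j \<in> X"
proof -
  have "x j \<noteq> a" if "a \<in> set u" for a
  proof -
    obtain i where "i < length u" "a = u ! i"
      using \<open>a \<in> set u\<close> by (auto simp: in_set_conv_nth)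
    then have "a = x i"
      using ramsey_nbhd_nth[OF assms(1)] by simp
    moreover have "x i < x j"
      using assms \<open>i < length u\<close> by (simp add: ramsey_nbhd_def strict_mono_less)
    ultimately show ?thesis
      by simp
  qed
  then show ?thesis
    using assms(1) by (auto simp: ramsey_nbhd_def)
qed

lemma ramsey_nbhd_sorted: "x \<in> ramsey_nbhd u X \<Longrightarrow> sorted_wrt (<) u"
  by (auto simp: sorted_wrt_iff_nth_less ramsey_nbhd_nth[symmetric])
    (simp add: ramsey_nbhd_def strict_mono_less)

lemma infinite_Int_greaterThan: "infinite (X :: nat set) \<Longrightarrow> infinite (X \<inter> {n<..})"
proof
  assume "infinite X" "finite (X \<inter> {n<..})"
  moreover have "X \<subseteq> (X \<inter> {n<..}) \<union> {..n}"
    by auto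
  ultimately show False
    by (meson finite_UnI finite_atMost finite_subset)
qed

text \<open>If the lemma failed for \<open>X\<close>, one could diagonalise: pick \<open>n\<^sub>0, n\<^sub>1, \<dots>\<close> so that
  each stem \<open>u @ [n\<^sub>i]\<close> misses \<open>A\<close> on a set containing all later picks.  Then the set of the
  \<open>n\<^sub>i\<close> would witness that \<open>X\<close> is not large for \<open>u\<close>.\<close>

lemma ramsey_large_snoc:
  assumes "ramsey_large A u X" "infinite X"
  shows "\<exists>Y\<subseteq>X. infinite Y \<and> (\<forall>n\<in>Y. ramsey_large A (u @ [n]) Y)"
proof (rule ccontr)
  assume neg: "\<not> ?thesis"
  have step: "\<exists>n Z. n \<in> Y \<and> Z \<subseteq> Y \<inter> {n<..} \<and> infinite Z \<and> ramsey_nbhd (u @ [n]) Z \<inter> A = {}"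
    if Y: "Y \<subseteq> X" "infinite Y" for Y
  proof -
    obtain n where n: "n \<in> Y" "\<not> ramsey_large A (u @ [n]) Y"
      using neg Y by blast
    then obtain Z where Z: "Z \<subseteq> Y" "infinite Z" "ramsey_nbhd (u @ [n]) Z \<inter> A = {}"
      unfolding ramsey_large_def by blast
    \<comment> \<open>Cutting \<open>Z\<close> above \<open>n\<close> forces the successive picks to
      increase and preserves disjointness from \<open>A\<close>.\<close>
    have "infinite (Z \<inter> {n<..})"
      using Z(2) by (rule infinite_Int_greaterThan)
    moreover have "ramsey_nbhd (u @ [n]) (Z \<inter> {n<..}) \<inter> A = {}"
      using Z(3) ramsey_nbhd_mono[of "Z \<inter> {n<..}" Z] by blast
    ultimately show ?thesis
      using Z(1) n(1) by (intro exI[of _ n] exI[of _ "Z \<inter> {n<..}"]) auto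
  qed
  define P where "P = (\<lambda>(n, Z). Z \<subseteq> X \<and> infinite Z \<and> ramsey_nbhd (u @ [n]) Z \<inter> A = {} \<and>
    n \<in> X \<and> Z \<subseteq> {n<..})"
  define R where "R = (\<lambda>(n :: nat, Z) (n', Z'). n' \<in> Z \<and> Z' \<subseteq> (Z :: nat set))"
  have "\<exists>f. \<forall>k :: nat. P (f k) \<and> R (f k) (f (Suc k))"
  proof (rule dependent_nat_choice)
    show "\<exists>p. P p"
    proof -
      obtain n Z where "n \<in> X" "Z \<subseteq> X \<inter> {n<..}" "infinite Z" "ramsey_nbhd (u @ [n]) Z \<inter> A = {}"
        using step[OF order_refl assms(2)] by blast
      then have "P (n, Z)"
        by (auto simp: P_def)
      then show ?thesis ..
    qed
    show "\<exists>q. P q \<and> R p q" if "P p" for p k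
    proof -
      obtain n Z where p: "p = (n, Z)"
        by fastforce
      with that have Z: "Z \<subseteq> X" "infinite Z"
        unfolding P_def by auto
      from step[OF this] obtain n' Z' where "n' \<in> Z" "Z' \<subseteq> Z \<inter> {n'<..}" "infinite Z'"
        "ramsey_nbhd (u @ [n']) Z' \<inter> A = {}"
        by blast
      then show ?thesis
        unfolding P_def R_def p using Z by (intro exI[of _ "(n', Z')"]) auto
    qed
  qed
  then obtain f where f: "\<And>k. P (f k)" "\<And>k. R (f k) (f (Suc k))"
    by blast
  define a where "a = fst \<circ> f"
  define Z where "Z = snd \<circ> f"
  have a: "a k \<in> X" "Z k \<subseteq> {a k<..}" "ramsey_nbhd (u @ [a k]) (Z k) \<inter> A = {}" for k
    using f(1)[of k] by (auto simp: P_def a_def Z_def split: prod.splits)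
  have "a (Suc k) \<in> Z k" "Z (Suc k) \<subseteq> Z k" for k
    using f(2)[of k] by (auto simp: R_def a_def Z_def split: prod.splits)
  then have anti: "antimono Z" and suc: "a (Suc k) \<in> Z k" for k
    by (simp_all add: decseq_SucI)
  have later: "a m \<in> Z k" if "k < m" for k m
    using that suc[of "m - 1"] antimonoD[OF anti, of k "m - 1"] by (cases m) auto
  have mono: "strict_mono a"
    using later a(2) by (auto simp: strict_mono_def)
  have "ramsey_nbhd u (range a) \<inter> A \<noteq> {}"
    using assms(1) a(1) range_inj_infinite[OF strict_mono_imp_inj_on[OF mono]]
    unfolding ramsey_large_def by blast
  then obtain x where x: "x \<in> ramsey_nbhd u (range a)" "x \<in> A"
    by blast
  \<comment> \<open>The first entry of \<open>x\<close> after the stem is some \<open>a k\<close>.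
    All later entries are picks \<open>a m\<close> with \<open>m > k\<close>, hence lie in
    \<open>Z k\<close>, so \<open>x\<close> falls into a neighbourhood that misses
    \<open>A\<close>.\<close>
  then obtain k where k: "x (length u) = a k"
    using ramsey_nbhd_tail[OF x(1), of "length u"] by auto
  have sm: "strict_mono x"
    using x(1) by (simp add: ramsey_nbhd_def)
  have "x j \<in> Z k" if "length u < j" for j
  proof -
    obtain m where m: "x j = a m"
      using ramsey_nbhd_tail[OF x(1), of j] \<open>length u < j\<close> by (auto simp: image_iff)
    moreover have "x (length u) < x j"
      using sm that by (simp add: strict_mono_less)
    ultimately have "k < m"
      using mono k by (simp add: strict_mono_less)
    then show ?thesis
      using later m by simp
  qed
  moreover have "x j \<in> set (u @ [a k])" if "j \<le> length u" for j
    using that k ramsey_nbhd_nth[OF x(1), of j] by (cases "j = length u") auto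
  ultimately have "range x - set (u @ [a k]) \<subseteq> Z k"
    by (auto simp: not_le[symmetric])
  then have "x \<in> ramsey_nbhd (u @ [a k]) (Z k)"
    using x(1) k by (auto simp: ramsey_nbhd_def)
  then show False
    using a(3) x(2) by blast
qed

text \<open>The stems are treated one after another; what was achieved for earlier stems survives
  shrinking the set.\<close>

lemma ramsey_large_snoc_finite:
  assumes "finite U" "\<And>u. u \<in> U \<Longrightarrow> ramsey_large A u X" "infinite X"
  shows "\<exists>Y\<subseteq>X. infinite Y \<and> (\<forall>u\<in>U. \<forall>n\<in>Y. ramsey_large A (u @ [n]) Y)"
  using assms(1,2)
proof (induction U rule: finite_induct)
  case empty
  then show ?case
    using assms(3) by blast
next
  case (insert u U)
  then obtain Y where Y: "Y \<subseteq> X" "infinite Y" "\<forall>u\<in>U. \<forall>n\<in>Y. ramsey_large A (u @ [n]) Y"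
    by blast
  have "ramsey_large A u Y"
    using insert.prems Y(1) ramsey_large_subset by blast
  then obtain Y' where "Y' \<subseteq> Y" "infinite Y'" "\<forall>n\<in>Y'. ramsey_large A (u @ [n]) Y'"
    using ramsey_large_snoc Y(2) by blast
  moreover from this(1) have "\<forall>u\<in>U. \<forall>n\<in>Y'. ramsey_large A (u @ [n]) Y'"
    using Y(3) ramsey_large_subset by blast
  ultimately show ?case
    using Y(1) by (intro exI[of _ Y']) auto
qed

text \<open>A fusion argument: finite sets \<open>F\<close> grow by one point per stage while
  infinite reservoirs shrink, and \<open>Z\<close> is the union of the \<open>F\<close>. A finite
  \<open>t\<close> from \<open>Z\<close> appears at some stage, and the reservoir of that stage
  serves as \<open>Y\<close>.\<close>

lemma ramsey_large_fusion:
  assumes "ramsey_large A s X" "infinite X"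
  shows "\<exists>Z. infinite Z \<and>
    (\<forall>t. sorted_wrt (<) t \<and> set t \<subseteq> Z \<longrightarrow> (\<exists>Y. infinite Y \<and> ramsey_large A (s @ t) Y))"
proof -
  \<comment> \<open>The invariant looks one point ahead: largeness is also kept for stems extended
    by a reservoir element, so any such element may be moved into \<open>F\<close>.\<close>
  define P where "P = (\<lambda>(F, X). finite F \<and> infinite X \<and> (\<forall>a\<in>F. \<forall>b\<in>X. a < b) \<and>
    (\<forall>t. sorted_wrt (<) t \<and> set t \<subseteq> F \<longrightarrow>
      ramsey_large A (s @ t) X \<and> (\<forall>n\<in>X. ramsey_large A ((s @ t) @ [n]) X)))"
  define R where "R = (\<lambda>(F, X) (F', X' :: nat set). \<exists>n\<in>X. F' = insert n F \<and> n \<notin> (F :: nat set))"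
  have "\<exists>f. \<forall>k :: nat. P (f k) \<and> R (f k) (f (Suc k))"
  proof (rule dependent_nat_choice)
    obtain Y where "Y \<subseteq> X" "infinite Y" "\<forall>n\<in>Y. ramsey_large A (s @ [n]) Y"
      using ramsey_large_snoc[OF assms] by blast
    then have "P ({}, Y)"
      using assms(1) unfolding P_def by (auto intro: ramsey_large_subset)
    then show "\<exists>p. P p" ..
    show "\<exists>q. P q \<and> R p q" if "P p" for p k
    proof -
      obtain F X where p: "p = (F, X)"
        by fastforce
      have F: "finite F" and X: "infinite X" and less: "\<And>a b. a \<in> F \<Longrightarrow> b \<in> X \<Longrightarrow> a < b"
        and large: "\<And>t. sorted_wrt (<) t \<Longrightarrow> set t \<subseteq> F \<Longrightarrow> ramsey_large A (s @ t) X"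
        and large_snoc: "\<And>t n. sorted_wrt (<) t \<Longrightarrow> set t \<subseteq> F \<Longrightarrow> n \<in> X \<Longrightarrow>
          ramsey_large A ((s @ t) @ [n]) X"
        using that unfolding p P_def by auto
      obtain n where n: "n \<in> X"
        using X by fastforce
      let ?T = "{t. sorted_wrt (<) t \<and> set t \<subseteq> insert n F}"
      have large': "ramsey_large A (s @ t) X" if "t \<in> ?T" for t
      proof (cases "n \<in> set t")
        case False
        then show ?thesis
          using that large by blast
      next
        case True
        then obtain t1 t2 where t: "t = t1 @ n # t2"
          by (meson split_list)
        \<comment> \<open>The new point \<open>n\<close> comes from the reservoir and exceeds all of
          \<open>F\<close>, so it can only be the last entry of \<open>t\<close>.\<close>
        have "t2 = []"
        proof (cases t2)
          case (Cons b t3)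
          then have "n < b" "b \<in> insert n F"
            using that by (auto simp: t sorted_wrt_append)
          then show ?thesis
            using less[of b n] n by auto
        qed simp
        moreover have "sorted_wrt (<) t1" "set t1 \<subseteq> F"
          using that by (auto simp: t sorted_wrt_append)
        ultimately show ?thesis
          using large_snoc n t by simp
      qed
      have "finite ?T"
      proof (rule finite_subset)
        show "?T \<subseteq> {t. set t \<subseteq> insert n F \<and> length t \<le> card (insert n F)}"
          using F by (auto intro!: card_mono simp: distinct_card[symmetric] strict_sorted_iff)
        show "finite {t. set t \<subseteq> insert n F \<and> length t \<le> card (insert n F)}"
          using F by (intro finite_lists_length_le) auto
      qed
      define X' where "X' = X \<inter> {n<..}"
      have "infinite X'"
        unfolding X'_def using X by (rule infinite_Int_greaterThan)
      moreover have "ramsey_large A u X'" if "u \<in> (@) s ` ?T" for u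
        using that large' by (auto simp: X'_def intro: ramsey_large_subset)
      \<comment> \<open>Shrinking once more for all stems over \<open>insert n F\<close> restores
        the look-ahead part of the invariant.\<close>
      ultimately obtain Y where Y: "Y \<subseteq> X'" "infinite Y"
          "\<forall>u\<in>(@) s ` ?T. \<forall>n\<in>Y. ramsey_large A (u @ [n]) Y"
        using ramsey_large_snoc_finite[of "(@) s ` ?T" A X'] \<open>finite ?T\<close> by blast
      have "Y \<subseteq> X" "\<forall>b\<in>Y. n < b"
        using Y(1) by (auto simp: X'_def)
      have "P (insert n F, Y)"
        unfolding P_def prod.case
      proof (intro conjI allI impI ballI)
        show "a < b" if "a \<in> insert n F" "b \<in> Y" for a b
          using that less \<open>Y \<subseteq> X\<close> \<open>\<forall>b\<in>Y. n < b\<close> by auto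
        fix t assume t: "sorted_wrt (<) t \<and> set t \<subseteq> insert n F"
        then show "ramsey_large A (s @ t) Y"
          using large'[of t] \<open>Y \<subseteq> X\<close> by (auto intro: ramsey_large_subset)
        show "ramsey_large A ((s @ t) @ [m]) Y" if "m \<in> Y" for m
          using Y(3) t that by blast
      qed (use F Y(2) in auto)
      moreover have "R (F, X) (insert n F, Y)"
        unfolding R_def using n less[of n n] by auto
      ultimately show ?thesis
        unfolding p by blast
    qed
  qed
  then obtain f where f: "\<And>k. P (f k)" "\<And>k. R (f k) (f (Suc k))"
    by blast
  define F where "F = fst \<circ> f"
  define Y where "Y = snd \<circ> f"
  have F: "finite (F k)" "infinite (Y k)"
    and large: "sorted_wrt (<) t \<Longrightarrow> set t \<subseteq> F k \<Longrightarrow> ramsey_large A (s @ t) (Y k)" for k t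
    using f(1)[of k] by (auto simp: P_def F_def Y_def split: prod.splits)
  have Suc: "\<exists>n. F (Suc k) = insert n (F k) \<and> n \<notin> F k" for k
    using f(2)[of k] by (auto simp: R_def F_def split: prod.splits)
  then have mono: "mono F"
    by (intro mono_iff_le_Suc[THEN iffD2]) blast
  have card: "k \<le> card (F k)" for k
  proof (induction k)
    case (Suc k)
    then show ?case
      using F(1)[of k] \<open>\<And>k. \<exists>n. F (Suc k) = insert n (F k) \<and> n \<notin> F k\<close>[of k] by auto
  qed simp
  have "infinite (\<Union>k. F k)"
  proof
    assume fin: "finite (\<Union>k. F k)"
    have "Suc (card (\<Union>k. F k)) \<le> card (\<Union>k. F k)"
      using card[of "Suc (card (\<Union>k. F k))"] card_mono[OF fin, of "F (Suc (card (\<Union>k. F k)))"]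
      by (meson UN_upper UNIV_I le_trans)
    then show False
      by simp
  qed
  moreover have "\<exists>Y. infinite Y \<and> ramsey_large A (s @ t) Y"
    if "sorted_wrt (<) t" "set t \<subseteq> (\<Union>k. F k)" for t
  proof -
    have "\<exists>k. U \<subseteq> F k" if "finite U" "U \<subseteq> (\<Union>k. F k)" for U
      using that
    proof (induction U rule: finite_induct)
      case (insert a U)
      then obtain k l where "U \<subseteq> F k" "a \<in> F l"
        by blast
      then have "insert a U \<subseteq> F (max k l)"
        using monoD[OF mono, of k "max k l"] monoD[OF mono, of l "max k l"] by auto
      then show ?case
        by blast
    qed simp
    then have "\<exists>k. set t \<subseteq> F k"
      using that(2) by blast
    then show ?thesis
      using large[OF that(1)] F(2) by blast
  qed
  ultimately show ?thesis
    by blast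
qed

section \<open>Cones inside trees\<close>

definition cone_tree :: "(nat \<Rightarrow> nat) \<Rightarrow> nat \<Rightarrow> nat list set" where
  "cone_tree x n =
    {t. sorted_wrt (<) t \<and> (\<forall>a\<in>set t. \<exists>i\<le>a. x i = a) \<and> (\<forall>i<length t. i < n \<longrightarrow> t ! i = x i)}"

lemma cone_tree_Trees: "cone_tree x n \<in> Trees"
proof (rule TreesI)
  fix s t assume st: "s @ t \<in> cone_tree x n"
  have "s ! i = x i" if "i < length s" "i < n" for i
  proof -
    have "(s @ t) ! i = x i"
      using st that unfolding cone_tree_def by simp
    then show ?thesis
      using that(1) by (simp add: nth_append)
  qed
  with st show "s \<in> cone_tree x n"
    by (simp add: cone_tree_def sorted_wrt_append)
qed

text \<open>The witness is \<open>s\<close> followed by the increasing enumeration of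
  \<open>S\<close>.\<close>

lemma ramsey_nbhd_nonempty:
  assumes "ramsey_pair s S"
  shows "\<exists>x. x \<in> ramsey_nbhd s S"
proof -
  define x where "x = (\<lambda>i. if i < length s then s ! i else enumerate S (i - length s))"
  have S: "infinite S" "sorted_wrt (<) s" "\<And>a b. a \<in> set s \<Longrightarrow> b \<in> S \<Longrightarrow> a < b"
    using assms by (auto simp: ramsey_pair_def)
  have "x i < x j" if "i < j" for i j
    using that S by (auto simp: x_def enumerate_in_set sorted_wrt_nth_less intro!: enumerate_mono)
  then have "strict_mono x"
    by (simp add: strict_mono_def)
  moreover have "map x [0..<length s] = s"
    by (intro nth_equalityI) (simp_all add: x_def)
  moreover have "range x - set s \<subseteq> S"
    using S by (auto simp: x_def enumerate_in_set)
  ultimately show ?thesis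
    unfolding ramsey_nbhd_def by blast
qed

text \<open>The first \<open>n\<close> values of \<open>x\<close> and its remaining range form a
  pair refuting nullness: after any thinning of the range the neighbourhood is still nonempty, and
  all its members are branches of the cone.\<close>

lemma not_ramsey_null_cone_tree:
  assumes "strict_mono x" "cone_tree x n \<subseteq> T"
  shows "\<not> ramsey_null (body T)"
proof
  assume null: "ramsey_null (body T)"
  define s where "s = map x [0..<n]"
  define S where "S = x ` {n..}"
  have inj: "inj x"
    using assms(1) by (rule strict_mono_imp_inj_on)
  have pair: "ramsey_pair s S"
    unfolding ramsey_pair_def
  proof (intro conjI)
    show "sorted_wrt (<) s"
      using assms(1) by (auto simp: s_def sorted_wrt_iff_nth_less strict_mono_less)
    show "infinite S"
      using inj by (auto simp: S_def finite_image_iff inj_on_subset infinite_Ici)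
    show "\<forall>a\<in>set s. \<forall>b\<in>S. a < b"
      using assms(1) by (auto simp: s_def S_def strict_mono_less)
  qed
  then obtain S' where S': "S' \<subseteq> S" "infinite S'" "ramsey_nbhd s S' \<inter> body T = {}"
    using null unfolding ramsey_null_def by blast
  then have "ramsey_pair s S'"
    using pair by (auto simp: ramsey_pair_def)
  then obtain y where y: "y \<in> ramsey_nbhd s S'"
    using ramsey_nbhd_nonempty by blast
  have range: "\<exists>i. x i = y j" for j
  proof (cases "j < n")
    case True
    then show ?thesis
      using ramsey_nbhd_nth[OF y, of j] by (auto simp: s_def)
  next
    case False
    then show ?thesis
      using ramsey_nbhd_tail[OF y, of j] S'(1) by (fastforce simp: s_def S_def)
  qed
  have "map y [0..<m] \<in> cone_tree x n" for m
    unfolding cone_tree_def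
  proof (intro CollectI conjI ballI)
    show "sorted_wrt (<) (map y [0..<m])"
      using y by (auto simp: ramsey_nbhd_def sorted_wrt_iff_nth_less strict_mono_less)
    show "\<exists>i\<le>a. x i = a" if a: "a \<in> set (map y [0..<m])" for a
    proof -
      obtain j where "a = y j"
        using a by auto
      then obtain i where "x i = a"
        using range by blast
      then show ?thesis
        using strict_mono_imp_increasing[OF assms(1), of i] by blast
    qed
    show "\<forall>i<length (map y [0..<m]). i < n \<longrightarrow> map y [0..<m] ! i = x i"
      using ramsey_nbhd_nth[OF y] by (auto simp: s_def)
  qed
  then have "y \<in> body T"
    using assms(2) by (auto simp: body_def)
  with y S'(3) show False
    by blast
qed

text \<open>Fusion gives, for every increasing \<open>t\<close> from \<open>Z\<close>, a branch of
  \<open>T\<close> through \<open>s @ t\<close>. That alone puts \<open>s @ t\<close> into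
  \<open>T\<close>; here it matters that the set is the body of a tree.\<close>

lemma not_ramsey_null_imp_cone_tree:
  assumes "T \<in> Trees" "\<not> ramsey_null (body T)"
  shows "\<exists>x n. strict_mono x \<and> cone_tree x n \<subseteq> T"
proof -
  obtain s S where pair: "ramsey_pair s S" and "ramsey_large (body T) s S"
    using assms(2) unfolding ramsey_null_def ramsey_large_def by blast
  then obtain Z where Z: "infinite Z" and
    ex: "\<And>t. sorted_wrt (<) t \<Longrightarrow> set t \<subseteq> Z \<Longrightarrow> \<exists>Y. infinite Y \<and> ramsey_large (body T) (s @ t) Y"
    using ramsey_large_fusion unfolding ramsey_pair_def by meson
  have branch: "\<exists>y\<in>body T. \<exists>Y. y \<in> ramsey_nbhd (s @ t) Y" if "sorted_wrt (<) t" "set t \<subseteq> Z" for t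
    using ex[OF that] unfolding ramsey_large_def by blast
  have T: "s @ t \<in> T" if t: "sorted_wrt (<) t" "set t \<subseteq> Z" for t
  proof -
    obtain y Y where y: "y \<in> body T" "y \<in> ramsey_nbhd (s @ t) Y"
      using branch[OF t] by blast
    then have "map y [0..<length (s @ t)] \<in> T" "map y [0..<length (s @ t)] = s @ t"
      unfolding body_def ramsey_nbhd_def by blast+
    then show ?thesis
      by argo
  qed
  have "ramsey_pair s Z"
    unfolding ramsey_pair_def
  proof (intro conjI ballI)
    fix a b assume "a \<in> set s" "b \<in> Z"
    \<comment> \<open>A branch through \<open>s @ [b]\<close> is increasing, so \<open>b\<close>
      lies above the whole stem.\<close>
    then show "a < b"
      using branch[of "[b]"] ramsey_nbhd_sorted by (fastforce simp: sorted_wrt_append)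
  qed (use pair Z in \<open>auto simp: ramsey_pair_def\<close>)
  then obtain x where x: "x \<in> ramsey_nbhd s Z"
    using ramsey_nbhd_nonempty by blast
  have sm: "strict_mono x"
    using x by (simp add: ramsey_nbhd_def)
  have "cone_tree x (length s) \<subseteq> T"
  proof
    fix t assume t: "t \<in> cone_tree x (length s)"
    then have s: "sorted_wrt (<) t" "\<forall>a\<in>set t. \<exists>i. x i = a" "\<forall>i<length t. i < length s \<longrightarrow> t ! i = s ! i"
      using ramsey_nbhd_nth[OF x] by (auto simp: cone_tree_def)
    show "t \<in> T"
    proof (cases "length t \<le> length s")
      case True
      then have "s = t @ drop (length t) s"
        using s(3) by (intro nth_equalityI) (auto simp: nth_append)
      then show ?thesis
        using T[of "[]"] TreesD[OF assms(1), of t "drop (length t) s"] by simp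
    next
      case False
      then have t': "t = s @ drop (length s) t"
        using s(3) by (intro nth_equalityI) (auto simp: nth_append)
      have "sorted_wrt (<) (s @ drop (length s) t)"
        using s(1) t' by simp
      then have "sorted_wrt (<) (drop (length s) t)" and less: "\<And>a b. a \<in> set s \<Longrightarrow> b \<in> set (drop (length s) t) \<Longrightarrow> a < b"
        by (auto simp: sorted_wrt_append)
      moreover have "b \<in> Z" if b: "b \<in> set (drop (length s) t)" for b
      proof -
        obtain i where "x i = b"
          using s(2) b by (meson in_set_dropD)
        moreover have "b \<notin> set s"
          using less[OF _ b] by blast
        ultimately show ?thesis
          using x by (auto simp: ramsey_nbhd_def)
      qed
      ultimately have "s @ drop (length s) t \<in> T"
        by (intro T) auto
      then show ?thesis
        using t' by simp
    qed
  qed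
  with sm show ?thesis
    by blast
qed

section \<open>Codes of closed sets that are not Ramsey-null form an analytic set\<close>

text \<open>A map of the Baire space onto the strictly increasing sequences whose values dominate
  the argument. Surjectivity serves the coding of cones, domination the hardness proof.\<close>

definition spread :: "(nat \<Rightarrow> nat) \<Rightarrow> nat \<Rightarrow> nat" where
  "spread d i = i + (\<Sum>j\<le>i. d j)"

lemma strict_mono_spread: "strict_mono (spread d)"
  by (simp add: strict_mono_Suc_iff spread_def)

lemma le_spread: "d i \<le> spread d i"
  by (simp add: spread_def trans_le_add2 member_le_sum)

lemma spread_surj:
  assumes "strict_mono x"
  shows "\<exists>d. spread d = x"
proof
  \<comment> \<open>The gaps of \<open>x\<close>, lowered by one because \<open>spread\<close>
    already adds one per step.\<close>
  let ?d = "\<lambda>i. if i = 0 then x 0 else x i - x (i - 1) - 1"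
  have "spread ?d i = x i" for i
  proof (induction i)
    case (Suc i)
    have "spread ?d (Suc i) = spread ?d i + Suc (?d (Suc i))"
      by (simp add: spread_def)
    also have "\<dots> = x i + Suc (x (Suc i) - x i - 1)"
      unfolding Suc.IH by simp
    also have "\<dots> = x (Suc i)"
      using strict_monoD[OF assms lessI, of i] by simp
    finally show ?case .
  qed (simp add: spread_def)
  then show "spread ?d = x"
    by (rule ext)
qed

text \<open>A code \<open>c\<close> packs three independent pieces: the length \<open>c (0, [])\<close> of the stem, the
  increments \<open>c (1, [j])\<close> of the increasing sequence generating the cone, and the zero pattern
  \<open>c (2, t)\<close> describing an arbitrary tree that is added to the cone.\<close>

definition tree_of_code :: "(nat \<times> nat list \<Rightarrow> nat) \<Rightarrow> nat list set" where
  "tree_of_code c =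
    {t. \<forall>i\<le>length t. c (2, take i t) = 0} \<union> cone_tree (spread (\<lambda>j. c (1, [j]))) (c (0, []))"

lemma tree_of_code_Trees: "tree_of_code c \<in> Trees"
proof (rule TreesI)
  fix s t assume "s @ t \<in> tree_of_code c"
  then consider "\<forall>i\<le>length (s @ t). c (2, take i (s @ t)) = 0"
    | "s @ t \<in> cone_tree (spread (\<lambda>j. c (1, [j]))) (c (0, []))"
    unfolding tree_of_code_def by blast
  then show "s \<in> tree_of_code c"
  proof cases
    case 1
    have "c (2, take i s) = 0" if "i \<le> length s" for i
      using 1 that spec[of _ i] by (auto dest!: spec[of _ i])
    then show ?thesis
      by (simp add: tree_of_code_def)
  next
    case 2
    then show ?thesis
      using TreesD[OF cone_tree_Trees] by (simp add: tree_of_code_def)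
  qed
qed

text \<open>Entries and positions of \<open>t\<close> are bounded by
  \<open>sum_list t + length t\<close>, and the search for an index with value \<open>a\<close>
  stops at \<open>a\<close>.\<close>

lemma cone_tree_cong:
  assumes "\<And>i. i \<le> sum_list t + length t \<Longrightarrow> x i = x' i"
  shows "t \<in> cone_tree x n \<longleftrightarrow> t \<in> cone_tree x' n"
proof -
  have "x i = x' i" if "i \<le> a" "a \<in> set t" for a i
    using that member_le_sum_list[of a t] by (intro assms) simp
  then have "(\<exists>i\<le>a. x i = a) \<longleftrightarrow> (\<exists>i\<le>a. x' i = a)" if "a \<in> set t" for a
    using that by metis
  moreover have "x i = x' i" if "i < length t" for i
    using that by (intro assms) simp
  ultimately show ?thesis
    unfolding cone_tree_def by simp
qed

text \<open>The finite set \<open>K t\<close> lists the coordinates that decide whether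
  \<open>t\<close> belongs to the tree; this yields continuity of the coding.\<close>

lemma tree_of_code_cong:
  defines "K t \<equiv> insert (0, []) ((\<lambda>i. (2, take i t)) ` {..length t} \<union>
    (\<lambda>j. (1, [j])) ` {..sum_list t + length t})"
  assumes "\<And>p. p \<in> K t \<Longrightarrow> c' p = c p"
  shows "t \<in> tree_of_code c' \<longleftrightarrow> t \<in> tree_of_code c"
proof -
  have stem: "c' (0, []) = c (0, [])"
    by (intro assms(2)) (simp add: K_def)
  have "c' (2, take i t) = c (2, take i t)" if "i \<le> length t" for i
    using that by (intro assms(2)) (simp add: K_def)
  then have zeros: "(\<forall>i\<le>length t. c' (2, take i t) = 0) \<longleftrightarrow> (\<forall>i\<le>length t. c (2, take i t) = 0)"
    by metis
  have "c' (1, [j]) = c (1, [j])" if "j \<le> sum_list t + length t" for j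
    using that by (intro assms(2)) (simp add: K_def)
  then have "spread (\<lambda>j. c' (1, [j])) i = spread (\<lambda>j. c (1, [j])) i"
    if "i \<le> sum_list t + length t" for i
    unfolding spread_def using that by (auto intro!: sum.cong)
  then have "t \<in> cone_tree (spread (\<lambda>j. c' (1, [j]))) n \<longleftrightarrow> t \<in> cone_tree (spread (\<lambda>j. c (1, [j]))) n" for n
    by (rule cone_tree_cong)
  then show ?thesis
    by (simp only: tree_of_code_def Un_iff mem_Collect_eq stem zeros)
qed

text \<open>The cone inside every coded tree prevents nullness. Conversely, a tree that is not null
  contains a cone, and taking the tree itself as zero pattern makes the union return it.\<close>

lemma range_tree_of_code: "range tree_of_code = {T \<in> Trees. \<not> ramsey_null (body T)}"
proof (intro set_eqI iffI)
  fix T assume "T \<in> range tree_of_code"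
  then obtain c where c: "T = tree_of_code c"
    by blast
  have "\<not> ramsey_null (body T)"
    unfolding c tree_of_code_def
    by (rule not_ramsey_null_cone_tree[OF strict_mono_spread Un_upper2])
  then show "T \<in> {T \<in> Trees. \<not> ramsey_null (body T)}"
    by (simp add: c tree_of_code_Trees)
next
  fix T assume "T \<in> {T \<in> Trees. \<not> ramsey_null (body T)}"
  then have T: "T \<in> Trees" "\<not> ramsey_null (body T)"
    by auto
  then obtain x n where "strict_mono x" and cone: "cone_tree x n \<subseteq> T"
    using not_ramsey_null_imp_cone_tree by blast
  then obtain d where d: "spread d = x"
    using spread_surj by blast
  \<comment> \<open>The increment with index \<open>j\<close> is stored at \<open>(1, [j])\<close>,
    whence \<open>hd s\<close>.\<close>
  define c where "c = (\<lambda>(k :: nat, s). if k = 0 then n else if k = 1 then d (hd s)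
    else if s \<in> T then 0 else 1)"
  have "take i t \<in> T" if "t \<in> T" for t i
    using TreesD[OF T(1), of "take i t" "drop i t"] that by simp
  then have prefixes: "(\<forall>i\<le>length t. take i t \<in> T) \<longleftrightarrow> t \<in> T" for t
    by (metis order_refl take_all)
  have "c (2, t) = 0 \<longleftrightarrow> t \<in> T" for t
    by (simp add: c_def)
  then have "{t. \<forall>i\<le>length t. c (2, take i t) = 0} = T"
    by (simp only: prefixes Collect_mem_eq)
  then have "tree_of_code c = T"
    unfolding tree_of_code_def using cone by (auto simp: c_def d)
  then show "T \<in> range tree_of_code"
    by blast
qed

lemma analytic_not_ramsey_null: "analytic_in tree_space {T \<in> Trees. \<not> ramsey_null (body T)}"
proof -
  let ?f = "\<lambda>y. tree_of_code (y \<circ> to_nat)"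
  have "continuous_map baire_space tree_space ?f"
  proof (rule continuous_map_tree_space)
    fix t :: "nat list"
    define K :: "(nat \<times> nat list) set" where "K = insert (0, []) ((\<lambda>i. (2, take i t)) ` {..length t} \<union>
      (\<lambda>j. (1, [j])) ` {..sum_list t + length t})"
    have fin: "finite (to_nat ` K)"
      by (simp add: K_def)
    have cong: "t \<in> ?f y' \<longleftrightarrow> t \<in> ?f y" if "\<And>k. k \<in> to_nat ` K \<Longrightarrow> y' k = y k" for y y' :: "nat \<Rightarrow> nat"
      using that by (intro tree_of_code_cong) (auto simp: K_def)
    have "openin baire_space {y. t \<in> ?f y}" "openin baire_space {y. t \<notin> ?f y}"
      by (rule openin_baire_space_dependence[OF fin]; use cong in blast)+
    then show "openin baire_space {y \<in> topspace baire_space. t \<in> ?f y}"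
      "openin baire_space {y \<in> topspace baire_space. t \<notin> ?f y}"
      by simp_all
  qed (simp add: tree_of_code_Trees)
  moreover have "range ?f = range tree_of_code"
  proof -
    \<comment> \<open>Since \<open>from_nat\<close> inverts \<open>to_nat\<close>, every code arises
      from a point of the Baire space.\<close>
    have "tree_of_code c = ?f (c \<circ> from_nat)" for c
      by (simp add: comp_def)
    then show ?thesis
      by blast
  qed
  ultimately show ?thesis
    unfolding analytic_in_def by (auto simp: range_tree_of_code)
qed

section \<open>Hardness\<close>

text \<open>Koenig's lemma. A node with extensions of every length has only finitely many candidate
  successors, so one of them again has extensions of every length.\<close>

lemma bounded_tree_branch:
  fixes Q :: "nat list \<Rightarrow> bool"
  assumes prefix: "\<And>t u. Q (t @ u) \<Longrightarrow> Q t"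
    and bounded: "\<And>t i. Q t \<Longrightarrow> i < length t \<Longrightarrow> t ! i \<le> b i"
    and long: "\<And>m. \<exists>t. length t = m \<and> Q t"
  shows "\<exists>z. \<forall>m. Q (map z [0..<m])"
proof -
  define P where "P t \<longleftrightarrow> (\<forall>m. \<exists>u. length u = m \<and> Q (t @ u))" for t
  have extend: "\<exists>a. P (t @ [a])" if P: "P t" for t
  proof (rule ccontr)
    assume "\<nexists>a. P (t @ [a])"
    then have "\<forall>a. \<exists>m. \<forall>u. length u = m \<longrightarrow> \<not> Q ((t @ [a]) @ u)"
      unfolding P_def by blast
    then obtain m where m: "\<And>a u. length u = m a \<Longrightarrow> \<not> Q ((t @ [a]) @ u)"
      by metis
    \<comment> \<open>One entry is for the successor \<open>a\<close>; the sum exceeds or equals the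
      failing length \<open>m a\<close> of each candidate.\<close>
    obtain u where u: "length u = Suc (\<Sum>a\<le>b (length t). m a)" "Q (t @ u)"
      using P unfolding P_def by blast
    then obtain a v where v: "u = a # v" "length v = (\<Sum>a\<le>b (length t). m a)"
      by (cases u) auto
    have "a \<le> b (length t)"
      using bounded[OF u(2), of "length t"] v(1) by simp
    then have "m a \<le> length v"
      unfolding v(2) by (intro member_le_sum) auto
    then have "length (take (m a) v) = m a"
      by simp
    moreover have "Q ((t @ [a]) @ take (m a) v)"
      using prefix[of "(t @ [a]) @ take (m a) v" "drop (m a) v"] u(2) v(1) by simp
    ultimately show False
      using m by blast
  qed
  have "\<exists>f. \<forall>k. (P (f k) \<and> length (f k) = k) \<and> (\<exists>a. f (Suc k) = f k @ [a])"
  proof (rule dependent_nat_choice)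
    show "\<exists>t. P t \<and> length t = 0"
      using long by (simp add: P_def)
    show "\<exists>t'. (P t' \<and> length t' = Suc k) \<and> (\<exists>a. t' = t @ [a])" if "P t \<and> length t = k" for t k
      using extend[of t] that by auto
  qed
  then obtain f where f: "\<And>k. P (f k)" "\<And>k. length (f k) = k" "\<And>k. \<exists>a. f (Suc k) = f k @ [a]"
    by blast
  have "map (\<lambda>i. f (Suc i) ! i) [0..<m] = f m" for m
  proof (induction m)
    case (Suc m)
    obtain a where "f (Suc m) = f m @ [a]"
      using f(3) by blast
    then show ?case
      using Suc f(2)[of m] by (simp add: nth_append)
  qed (use f(2)[of 0] in simp)
  moreover have "Q (f m)" for m
    using f(1)[of m] prefix unfolding P_def by blast
  ultimately show ?thesis
    by (intro exI[of _ "\<lambda>i. f (Suc i) ! i"]) simp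
qed

section \<open>Cylinders of the Baire space and domination trees\<close>

definition cylinder :: "nat list \<Rightarrow> (nat \<Rightarrow> nat) set" where
  "cylinder t = {z. map z [0..<length t] = t}"

lemma cylinder_append: "cylinder (t @ u) \<subseteq> cylinder t"
proof
  fix z assume "z \<in> cylinder (t @ u)"
  then have "map z [0..<length (t @ u)] = t @ u"
    by (simp only: cylinder_def mem_Collect_eq)
  moreover have "map z [0..<length t] = take (length t) (map z [0..<length (t @ u)])"
    by (simp add: take_map)
  ultimately show "z \<in> cylinder t"
    by (simp add: cylinder_def)
qed

lemma openin_baire_space_cylinder:
  assumes "openin baire_space U" "z \<in> U"
  shows "\<exists>n. cylinder (map z [0..<n]) \<subseteq> U"
proof -
  from bspec[OF assms(1)[unfolded baire_space_def openin_power_discrete] assms(2)]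
  obtain K where K: "finite K" "\<forall>z'. (\<forall>k\<in>K. z' k = z k) \<longrightarrow> z' \<in> U"
    by (elim exE conjE)
  obtain n where n: "K \<subseteq> {..<n}"
    using finite_nat_bounded[OF K(1)] by blast
  have "z' \<in> U" if "z' \<in> cylinder (map z [0..<n])" for z'
  proof -
    have "map z' [0..<n] = map z [0..<n]"
      using that by (simp add: cylinder_def)
    then have "\<forall>k\<in>K. z' k = z k"
      using n by (auto simp: subset_eq)
    then show ?thesis
      using K(2) by simp
  qed
  then show ?thesis
    by blast
qed

text \<open>If \<open>g z\<close> and \<open>y\<close> had disjoint neighbourhoods, continuity would
  send a whole cylinder around \<open>z\<close> into that of \<open>g z\<close>, keeping
  \<open>y\<close> out of the closure.\<close>

lemma closure_of_cylinders:
  assumes "continuous_map baire_space Y g" "Hausdorff_space Y"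
    and "\<And>n. y \<in> Y closure_of (g ` cylinder (map z [0..<n]))"
  shows "g z = y"
proof (rule ccontr)
  assume "g z \<noteq> y"
  moreover have "g z \<in> topspace Y" "y \<in> topspace Y"
    using continuous_map_image_subset_topspace[OF assms(1)] assms(3)[of 0] by (auto simp: in_closure_of)
  ultimately obtain U V where UV: "openin Y U" "openin Y V" "y \<in> U" "g z \<in> V" "disjnt U V"
    using assms(2) unfolding Hausdorff_space_def by metis
  have "openin baire_space {z' \<in> topspace baire_space. g z' \<in> V}"
    using assms(1) UV(2) by (rule openin_continuous_map_preimage)
  then obtain n where "cylinder (map z [0..<n]) \<subseteq> {z' \<in> topspace baire_space. g z' \<in> V}"
    using openin_baire_space_cylinder[of _ z] UV(4) by fastforce
  then have "g ` cylinder (map z [0..<n]) \<subseteq> V"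
    by blast
  moreover have "\<exists>v. v \<in> g ` cylinder (map z [0..<n]) \<and> v \<in> U"
    using assms(3)[of n] UV(1,3) unfolding in_closure_of by blast
  ultimately show False
    using UV(5) by (auto simp: disjnt_iff)
qed

text \<open>Passing from a tree to the sequences that dominate one of its members turns a single branch
  into a whole cone of increasing branches, and by compactness creates no new branches over a
  well-founded tree.\<close>

definition domination_tree :: "'a topology \<Rightarrow> ((nat \<Rightarrow> nat) \<Rightarrow> 'a) \<Rightarrow> 'a \<Rightarrow> nat list set" where
  "domination_tree Y g y =
    {s. \<exists>t. list_all2 (\<le>) t s \<and> y \<in> Y closure_of (g ` cylinder t)}"

lemma closure_of_cylinder_append:
  "y \<in> Y closure_of (g ` cylinder (t @ u)) \<Longrightarrow> y \<in> Y closure_of (g ` cylinder t)"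
  using closure_of_mono[OF image_mono[OF cylinder_append[of t u]], of Y g] by blast

lemma domination_tree_Trees: "domination_tree Y g y \<in> Trees"
proof (rule TreesI)
  fix s s' assume "s @ s' \<in> domination_tree Y g y"
  then obtain t where t: "list_all2 (\<le>) t (s @ s')" "y \<in> Y closure_of (g ` cylinder t)"
    unfolding domination_tree_def by blast
  from t(1) obtain u v where "t = u @ v" "list_all2 (\<le>) u s"
    by (auto simp: list_all2_append2)
  moreover from this t(2) have "y \<in> Y closure_of (g ` cylinder u)"
    using closure_of_cylinder_append[of y Y g u v] by simp
  ultimately show "s \<in> domination_tree Y g y"
    unfolding domination_tree_def by blast
qed

text \<open>Only finitely many \<open>t\<close> lie below \<open>s\<close>, so the set is a finite
  union of closures.\<close>

lemma borel_domination_tree: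
  "{y \<in> topspace Y. s \<in> domination_tree Y g y} \<in> sets (borel_of Y)"
proof -
  have "finite {t. list_all2 (\<le>) t s}"
  proof (rule finite_subset)
    show "{t. list_all2 (\<le>) t s} \<subseteq> {t. set t \<subseteq> {..sum_list s} \<and> length t = length s}"
    proof
      fix t assume "t \<in> {t. list_all2 (\<le>) t s}"
      then have t: "list_all2 (\<le>) t s"
        by simp
      have "a \<le> sum_list s" if a: "a \<in> set t" for a
      proof -
        obtain i where i: "i < length t" "a = t ! i"
          using a by (auto simp: in_set_conv_nth)
        then have "a \<le> s ! i" "i < length s"
          using t by (auto simp: list_all2_conv_all_nth)
        then show ?thesis
          using elem_le_sum_list[of i s] by simp
      qed
      then show "t \<in> {t. set t \<subseteq> {..sum_list s} \<and> length t = length s}"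
        using list_all2_lengthD[OF t] by auto
    qed
    show "finite {t. set t \<subseteq> {..sum_list s} \<and> length t = length s}"
      by (rule finite_lists_length_eq) simp
  qed
  then have "(\<Union>t\<in>{t. list_all2 (\<le>) t s}. Y closure_of (g ` cylinder t)) \<in> sets (borel_of Y)"
    by (intro sets.finite_UN closedin_borel_of closedin_closure_of)
  moreover have "{y \<in> topspace Y. s \<in> domination_tree Y g y} =
      (\<Union>t\<in>{t. list_all2 (\<le>) t s}. Y closure_of (g ` cylinder t))"
    unfolding domination_tree_def using closure_of_subset_topspace[of Y] by auto
  ultimately show ?thesis
    by simp
qed

text \<open>The witnesses \<open>t\<close> below a branch \<open>x\<close> form a tree bounded by
  \<open>x\<close>. Koenig's lemma gives \<open>z\<close> with \<open>y\<close> in the closure for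
  each initial segment, hence \<open>g z = y\<close>.\<close>

lemma body_domination_tree_empty:
  assumes "continuous_map baire_space Y g" "Hausdorff_space Y" "y \<notin> range g"
  shows "body (domination_tree Y g y) = {}"
proof (rule ccontr)
  assume "body (domination_tree Y g y) \<noteq> {}"
  then obtain x where x: "\<And>n. map x [0..<n] \<in> domination_tree Y g y"
    by (auto simp: body_def)
  let ?Q = "\<lambda>t. list_all2 (\<le>) t (map x [0..<length t]) \<and> y \<in> Y closure_of (g ` cylinder t)"
  have "\<exists>z. \<forall>m. ?Q (map z [0..<m])"
  proof (rule bounded_tree_branch)
    show "?Q t" if "?Q (t @ u)" for t u
      using that closure_of_cylinder_append[of y Y g t u]
      by (auto simp: list_all2_conv_all_nth nth_append) (metis trans_less_add1)
    show "t ! i \<le> x i" if "?Q t" "i < length t" for t i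
      using that by (auto simp: list_all2_conv_all_nth)
    show "\<exists>t. length t = m \<and> ?Q t" for m
    proof -
      obtain t where t: "list_all2 (\<le>) t (map x [0..<m])" "y \<in> Y closure_of (g ` cylinder t)"
        using x[of m] unfolding domination_tree_def by blast
      moreover from t(1) have "length t = m"
        using list_all2_lengthD by fastforce
      ultimately show ?thesis
        by blast
    qed
  qed
  then obtain z where "\<And>m. y \<in> Y closure_of (g ` cylinder (map z [0..<m]))"
    by blast
  then have "g z = y"
    by (rule closure_of_cylinders[OF assms(1,2)])
  with assms(3) show False
    by blast
qed

text \<open>Indices in \<open>x\<close> of successive entries of \<open>t\<close> increase strictly,
  so the entry at position \<open>i\<close> is \<open>x k\<close> for some
  \<open>k \<ge> i\<close>.\<close>

lemma cone_tree_nth_ge: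
  assumes "strict_mono x" "t \<in> cone_tree x n" "i < length t"
  shows "x i \<le> t ! i"
proof -
  have sorted: "sorted_wrt (<) t" and range: "\<And>i. i < length t \<Longrightarrow> \<exists>k. x k = t ! i"
    using assms(2) nth_mem by (auto simp: cone_tree_def)
  have "\<exists>k\<ge>i. x k = t ! i"
    using assms(3)
  proof (induction i)
    case 0
    then show ?case
      using range by blast
  next
    case (Suc i)
    then obtain k l where k: "i \<le> k" "x k = t ! i" "x l = t ! Suc i"
      using range[of "Suc i"] by auto
    moreover have "t ! i < t ! Suc i"
      using sorted Suc.prems by (simp add: sorted_wrt_nth_less)
    ultimately have "k < l"
      using assms(1) by (metis strict_mono_less)
    with k show ?case
      by (intro exI[of _ l]) simp
  qed
  then show ?thesis
    using assms(1) by (metis strict_mono_less_eq)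
qed

text \<open>The cone of \<open>spread z\<close> with empty stem works: its members dominate
  \<open>spread z\<close>, hence \<open>z\<close>, and the initial segments of \<open>z\<close> are
  the required witnesses.\<close>

lemma not_ramsey_null_domination_tree:
  assumes "continuous_map baire_space Y g"
  shows "\<not> ramsey_null (body (domination_tree Y g (g z)))"
proof (rule not_ramsey_null_cone_tree[OF strict_mono_spread])
  show "cone_tree (spread z) 0 \<subseteq> domination_tree Y g (g z)"
  proof
    fix s assume s: "s \<in> cone_tree (spread z) 0"
    let ?t = "map z [0..<length s]"
    have "z i \<le> s ! i" if "i < length s" for i
      using le_spread[of z i] cone_tree_nth_ge[OF strict_mono_spread s that] by simp
    then have "list_all2 (\<le>) ?t s"
      by (simp add: list_all2_conv_all_nth)
    moreover have "g z \<in> g ` cylinder ?t"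
      by (simp add: cylinder_def)
    then have "g z \<in> Y closure_of (g ` cylinder ?t)"
      using closure_of_subset[of "g ` cylinder ?t" Y] continuous_map_image_subset_topspace[OF assms]
      by auto
    ultimately show "s \<in> domination_tree Y g (g z)"
      unfolding domination_tree_def by blast
  qed
qed

lemma ramsey_null_empty: "ramsey_null {}"
  unfolding ramsey_null_def ramsey_pair_def by blast

lemma borel_reducible_not_ramsey_null:
  assumes "polish Y" "analytic_in Y B"
  shows "borel_reducible Y B tree_space {T \<in> Trees. \<not> ramsey_null (body T)}"
proof (cases "B = {}")
  case True
  \<comment> \<open>The empty set is no continuous image of the Baire space; it is reduced by the
    constant map to the empty tree, whose body is null.\<close>
  have "{} \<in> Trees" "body {} = {}"
    by (auto simp: Trees_def body_def)
  then have "(\<lambda>_. {}) \<in> measurable (borel_of Y) (borel_of tree_space)"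
    by (intro measurable_const) simp
  moreover have "(\<lambda>_. {}) -` {T \<in> Trees. \<not> ramsey_null (body T)} \<inter> topspace Y = B"
    using True \<open>body {} = {}\<close> by (auto simp: ramsey_null_empty)
  ultimately show ?thesis
    unfolding borel_reducible_def by blast
next
  case False
  then obtain g where g: "continuous_map baire_space Y g" "range g = B"
    using assms(2) by (auto simp: analytic_in_def)
  have haus: "Hausdorff_space Y"
    using assms(1) unfolding polish_def
    by (simp add: completely_metrizable_imp_metrizable_space metrizable_imp_Hausdorff_space)
  have null_iff: "ramsey_null (body (domination_tree Y g y)) \<longleftrightarrow> y \<notin> B" for y
    using body_domination_tree_empty[OF g(1) haus, of y] not_ramsey_null_domination_tree[OF g(1)] g(2)
    by (auto simp: ramsey_null_empty)
  have "B \<subseteq> topspace Y"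
    using continuous_map_image_subset_topspace[OF g(1)] g(2) by simp
  then have "domination_tree Y g -` {T \<in> Trees. \<not> ramsey_null (body T)} \<inter> topspace Y = B"
    by (auto simp: null_iff domination_tree_Trees)
  moreover have "domination_tree Y g \<in> measurable (borel_of Y) (borel_of tree_space)"
    by (intro measurable_tree_space domination_tree_Trees borel_domination_tree)
  ultimately show ?thesis
    unfolding borel_reducible_def by blast
qed

theorem corollary3p4:
  shows "Pi11_complete TYPE('b) tree_space {T \<in> Trees. ramsey_null (body T)}"
proof -
  have "topspace tree_space - {T \<in> Trees. ramsey_null (body T)} =
      {T \<in> Trees. \<not> ramsey_null (body T)}"
    by auto
  then show ?thesis
    unfolding Pi11_complete_def Sigma11_complete_def
    using polish_tree_space analytic_not_ramsey_null borel_reducible_not_ramsey_null by auto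
qed

end
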